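(* Fix an integer $N\ge 0$. Let $\mathscr{A}$ be the set of quintuples $(n;\alpha,\beta,\gamma,\lambda,\mu)$, where $n\ge 0$ is an integer and $\alpha,\beta,\gamma,\lambda,\mu$ are partitions, such that: $\alpha$ has distinct positive parts; $\beta$ has positive parts; $\gamma$ has distinct nonnegative parts; $\lambda$ has distinct nonnegative parts, each $\le n-1$; $\mu$ has nonnegative parts, each $\le n-1$; and $n-l(\gamma)=N$. Let $\mathscr{B}$ be the set of quintuples $(A,B,C,D,E)$ of partitions such that: $A$ and $C$ have distinct nonnegative parts; $B$ and $D$ have nonnegative parts; $E$ has distinct positive parts; and $l(C)+l(D)-l(E)=N$. Then there is a bijection $\mathscr{A}\to\mathscr{B}$, $(n;\alpha,\beta,\gamma,\lambda,\mu)\mapsto(A,B,C,D,E)$, such that $|\alpha|+|\beta|+|\gamma|+|\lambda|+|\mu|=|A|+|B|+|C|+|D|+|E|$, $l(\lambda)-l(\alpha)-l(\gamma)=l(C)-l(A)-l(E)$, and $l(\gamma)+l(\mu)=l(A)+l(B)$.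
   Context: A partition $\lambda=(\lambda_1,\dots,\lambda_r)$ is a finite sequence of integers with $\lambda_1\ge\cdots\ge\lambda_r\ge 0$; zero parts are allowed and are counted among the parts. Its length is $l(\lambda)=r$ and its weight is $|\lambda|=\sum_i\lambda_i$. A partition has distinct parts if its parts are strictly decreasing. (In the paper, the statistics $|\cdot|$, the $a$-exponent $l(\lambda)-l(\alpha)-l(\gamma)$ resp. $l(C)-l(A)-l(E)$, and the $b$-exponent $l(\gamma)+l(\mu)$ resp. $l(A)+l(B)$ are the statistics tracked by the generating functions of the two sides of the coefficient of $z^N$ in the identity $\frac{(-q/a;q)_\infty(-b/az;q)_\infty}{(q;q)_\infty}\sum_{n=-\infty}^{\infty}\frac{(-a;q)_n}{(b;q)_n}z^n=\frac{(-b/a;q)_\infty(-az;q)_\infty(-q/az;q)_\infty}{(b;q)_\infty(z;q)_\infty}$.) *)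

theory Defs
  imports Complex_Main
begin

text \<open>
  A partition is the list of its parts in weakly decreasing order. Zero parts are allowed
  and count towards the length, so that \<open>[2, 0]\<close> and \<open>[2]\<close> are different partitions. The length
  and the weight of a partition are \<^const>\<open>length\<close> and \<^const>\<open>sum_list\<close>.
\<close>

type_synonym parts = "nat list"

definition is_partition :: "parts \<Rightarrow> bool" where
  "is_partition xs \<longleftrightarrow> sorted_wrt (\<ge>) xs"

definition distinct_parts :: "parts \<Rightarrow> bool" where
  "distinct_parts xs \<longleftrightarrow> sorted_wrt (>) xs"

definition positive_parts :: "parts \<Rightarrow> bool" where
  "positive_parts xs \<longleftrightarrow> (\<forall>p\<in>set xs. 0 < p)"

text \<open>
  The bound \<open>n - 1\<close> is an integer: for \<open>n = 0\<close> it is \<open>-1\<close>, which only the empty partition satisfies.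
\<close>

definition parts_at_most :: "int \<Rightarrow> parts \<Rightarrow> bool" where
  "parts_at_most m xs \<longleftrightarrow> (\<forall>p\<in>set xs. int p \<le> m)"

text \<open>
  Below, \<open>\<kappa>\<close> is the partition usually written as a lambda, which is not available as a variable name.
\<close>

definition script_A :: "nat \<Rightarrow> (nat \<times> parts \<times> parts \<times> parts \<times> parts \<times> parts) set" where
  "script_A N = {(n, \<alpha>, \<beta>, \<gamma>, \<kappa>, \<mu>).
     is_partition \<alpha> \<and> distinct_parts \<alpha> \<and> positive_parts \<alpha> \<and>
     is_partition \<beta> \<and> positive_parts \<beta> \<and>
     is_partition \<gamma> \<and> distinct_parts \<gamma> \<and>
     is_partition \<kappa> \<and> distinct_parts \<kappa> \<and> parts_at_most (int n - 1) \<kappa> \<and>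
     is_partition \<mu> \<and> parts_at_most (int n - 1) \<mu> \<and>
     int n - int (length \<gamma>) = int N}"

definition script_B :: "nat \<Rightarrow> (parts \<times> parts \<times> parts \<times> parts \<times> parts) set" where
  "script_B N = {(A, B, C, D, E).
     is_partition A \<and> distinct_parts A \<and>
     is_partition B \<and>
     is_partition C \<and> distinct_parts C \<and>
     is_partition D \<and>
     is_partition E \<and> distinct_parts E \<and> positive_parts E \<and>
     int (length C) + int (length D) - int (length E) = int N}"

end

theory Submission
  imports Defs "HOL-Library.Infinite_Set"
begin

text \<open>
  Comparing the coefficients of \<open>z\<^sup>N\<close> splits the identity into two independent ones, each proved by a
  bijection. The parts of \<open>\<kappa>\<close> that are at least \<open>N\<close> mark some of the \<open>m\<close> parts of \<open>\<gamma>\<close>. The unmarked parts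
  form \<open>A\<close>; the marked ones, renumbered among the gaps of \<open>A\<close>, become a partition with parts at least
  \<open>N + m - 1\<close>, which \<open>\<mu>\<close> completes to \<open>B\<close> (a Durfee rectangle dissection). What is left of \<open>\<kappa>\<close> has
  parts below \<open>N\<close>. Complementing it and adjoining the shifted parts of \<open>\<alpha>\<close> gives an arbitrary finite set,
  hence \<open>D\<close>, and \<open>\<beta>\<close> becomes the pair \<open>(C, E)\<close> by the Jacobi triple product, which itself is the limit
  \<open>N \<rightarrow> \<infinity>\<close> of the former correspondence.
\<close>

subsection \<open>Bijections that preserve a statistic\<close>

text \<open>Only the existence of the map is recorded, so that the final bijection arises by
  transitivity and the composite never has to be written out.\<close>

definition stat_equiv :: "'a set \<Rightarrow> ('a \<Rightarrow> 's) \<Rightarrow> 'b set \<Rightarrow> ('b \<Rightarrow> 's) \<Rightarrow> bool" where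
  "stat_equiv X f Y g \<longleftrightarrow> (\<exists>h. bij_betw h X Y \<and> (\<forall>x\<in>X. g (h x) = f x))"

lemma stat_equivI:
  assumes "\<And>x. x \<in> X \<Longrightarrow> h x \<in> Y" "\<And>x. x \<in> X \<Longrightarrow> h' (h x) = x" "\<And>x. x \<in> X \<Longrightarrow> g (h x) = f x"
    and "\<And>y. y \<in> Y \<Longrightarrow> h' y \<in> X" "\<And>y. y \<in> Y \<Longrightarrow> h (h' y) = y"
  shows "stat_equiv X f Y g"
  unfolding stat_equiv_def
  by (intro exI[of _ h] conjI ballI bij_betw_byWitness[where f' = h']) (use assms in auto)

lemma stat_equiv_refl:
  assumes "\<And>x. x \<in> X \<Longrightarrow> g x = f x"
  shows "stat_equiv X f X g"
  by (rule stat_equivI[where h = id and h' = id]) (use assms in auto)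

lemma stat_equiv_sym:
  assumes "stat_equiv X f Y g"
  shows "stat_equiv Y g X f"
proof -
  obtain h where h: "bij_betw h X Y" "\<forall>x\<in>X. g (h x) = f x"
    using assms unfolding stat_equiv_def by blast
  have "f (inv_into X h y) = g y" if "y \<in> Y" for y
    using that h bij_betwE[OF bij_betw_inv_into[OF h(1)]] bij_betw_inv_into_right[OF h(1)] by metis
  then show ?thesis using bij_betw_inv_into[OF h(1)] unfolding stat_equiv_def by blast
qed

lemma stat_equiv_trans [trans]:
  assumes "stat_equiv X f Y g" "stat_equiv Y g Z k"
  shows "stat_equiv X f Z k"
proof -
  obtain h where h: "bij_betw h X Y" "\<forall>x\<in>X. g (h x) = f x"
    using assms(1) unfolding stat_equiv_def by blast
  obtain h' where h': "bij_betw h' Y Z" "\<forall>x\<in>Y. k (h' x) = g x"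
    using assms(2) unfolding stat_equiv_def by blast
  show ?thesis unfolding stat_equiv_def
    by (intro exI[of _ "h' \<circ> h"] conjI ballI bij_betw_trans[OF h(1) h'(1)])
      (use h h' bij_betwE in fastforce)
qed

text \<open>The same bijection serves any statistic computed from the old one. The intermediate
  equivalences therefore track rich tuples, and \<open>u\<close> recombines their components
  afterwards.\<close>

lemma stat_equiv_map:
  assumes "stat_equiv X f Y g" "\<And>x. x \<in> X \<Longrightarrow> f' x = u (f x)" "\<And>y. y \<in> Y \<Longrightarrow> g' y = u (g y)"
  shows "stat_equiv X f' Y g'"
  using assms unfolding stat_equiv_def by (metis bij_betwE)

lemma stat_equiv_Collect:
  assumes "stat_equiv X f Y g"
  shows "stat_equiv {x \<in> X. Q (f x)} f {y \<in> Y. Q (g y)} g"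
proof -
  obtain h where h: "bij_betw h X Y" "\<forall>x\<in>X. g (h x) = f x"
    using assms unfolding stat_equiv_def by blast
  have "bij_betw h {x \<in> X. Q (f x)} {y \<in> Y. Q (g y)}"
    using h unfolding bij_betw_def inj_on_def by (auto simp: image_iff)
  then show ?thesis using h(2) unfolding stat_equiv_def by blast
qed

text \<open>Bijections chosen independently on the fibres of the statistic glue together. This is
  what allows a passage to the limit: the construction may depend on the value
  \<open>v\<close>.\<close>

lemma stat_equiv_fibres:
  assumes "\<And>v. stat_equiv {x \<in> X. f x = v} f {y \<in> Y. g y = v} g"
  shows "stat_equiv X f Y g"
proof -
  obtain h where h: "\<And>v. bij_betw (h v) {x \<in> X. f x = v} {y \<in> Y. g y = v}"
    using assms unfolding stat_equiv_def by metis
  have "bij_betw (\<lambda>x. h (f x) x) X Y"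
  proof (rule bij_betw_byWitness[where f' = "\<lambda>y. inv_into {x \<in> X. f x = g y} (h (g y)) y"])
    have im: "h (f x) x \<in> Y \<and> g (h (f x) x) = f x" if "x \<in> X" for x
      using bij_betwE[OF h[of "f x"]] that by auto
    have im': "inv_into {x \<in> X. f x = g y} (h (g y)) y \<in> X \<and>
        f (inv_into {x \<in> X. f x = g y} (h (g y)) y) = g y" if "y \<in> Y" for y
      using bij_betwE[OF bij_betw_inv_into[OF h[of "g y"]]] that by auto
    show "\<forall>x\<in>X. inv_into {x' \<in> X. f x' = g (h (f x) x)} (h (g (h (f x) x))) (h (f x) x) = x"
      using im h by (auto intro!: bij_betw_inv_into_left)
    show "\<forall>y\<in>Y. h (f (inv_into {x \<in> X. f x = g y} (h (g y)) y))
        (inv_into {x \<in> X. f x = g y} (h (g y)) y) = y"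
      using im' h by (auto intro!: bij_betw_inv_into_right)
    show "(\<lambda>x. h (f x) x) ` X \<subseteq> Y" using im by auto
    show "(\<lambda>y. inv_into {x \<in> X. f x = g y} (h (g y)) y) ` Y \<subseteq> X" using im' by auto
  qed
  moreover have "g (h (f x) x) = f x" if "x \<in> X" for x
    using bij_betwE[OF h[of "f x"]] that by auto
  ultimately show ?thesis unfolding stat_equiv_def by blast
qed

text \<open>The second component may depend on the first, but only through the statistic. The
  bijection of the bases preserves it, so the fibre over \<open>x\<close> and the fibre over its
  image are the same set.\<close>

lemma stat_equiv_Sigma_base:
  assumes "stat_equiv X f Y g"
  shows "stat_equiv (Sigma X (\<lambda>x. M (f x))) (\<lambda>(x, z). (f x, z)) (Sigma Y (\<lambda>y. M (g y))) (\<lambda>(y, z). (g y, z))"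
proof -
  obtain h where h: "bij_betw h X Y" "\<forall>x\<in>X. g (h x) = f x"
    using assms unfolding stat_equiv_def by blast
  have "bij_betw (\<lambda>(x, z). (h x, z)) (Sigma X (\<lambda>x. M (f x))) (Sigma Y (\<lambda>y. M (g y)))"
    using h unfolding bij_betw_def inj_on_def by (auto simp: image_iff)
  then show ?thesis using h(2) unfolding stat_equiv_def
    by (intro exI[of _ "\<lambda>(x, z). (h x, z)"]) auto
qed

lemma stat_equiv_Sigma_fibre:
  assumes "\<And>x. x \<in> X \<Longrightarrow> stat_equiv (M x) (f x) (M' x) (g x)"
  shows "stat_equiv (Sigma X M) (\<lambda>(x, z). (x, f x z)) (Sigma X M') (\<lambda>(x, z). (x, g x z))"
proof -
  have "\<exists>h. \<forall>x\<in>X. bij_betw (h x) (M x) (M' x) \<and> (\<forall>z\<in>M x. g x (h x z) = f x z)"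
    using assms unfolding stat_equiv_def by metis
  then obtain h where h: "\<And>x. x \<in> X \<Longrightarrow> bij_betw (h x) (M x) (M' x)"
      "\<And>x z. x \<in> X \<Longrightarrow> z \<in> M x \<Longrightarrow> g x (h x z) = f x z"
    by blast
  have "bij_betw (\<lambda>(x, z). (x, h x z)) (Sigma X M) (Sigma X M')"
    using h(1) unfolding bij_betw_def inj_on_def by (force simp: image_iff)
  then show ?thesis using h(2) unfolding stat_equiv_def
    by (intro exI[of _ "\<lambda>(x, z). (x, h x z)"]) auto
qed

lemma stat_equiv_Times:
  assumes "stat_equiv X f Y g" "stat_equiv X' f' Y' g'"
  shows "stat_equiv (X \<times> X') (\<lambda>(x, z). (f x, f' z)) (Y \<times> Y') (\<lambda>(y, z). (g y, g' z))"
proof -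
  have "stat_equiv (X \<times> X') (\<lambda>(x, z). (f x, f' z)) (Y \<times> X') (\<lambda>(y, z). (g y, f' z))"
    using stat_equiv_map[OF stat_equiv_Sigma_base[OF assms(1), of "\<lambda>_. X'"], where u = "\<lambda>(x, z). (x, f' z)"]
    by (simp add: split_beta)
  also have "stat_equiv (Y \<times> X') (\<lambda>(y, z). (g y, f' z)) (Y \<times> Y') (\<lambda>(y, z). (g y, g' z))"
    using stat_equiv_map[OF stat_equiv_Sigma_fibre[of Y "\<lambda>_. X'" "\<lambda>_. f'" "\<lambda>_. Y'" "\<lambda>_. g'"],
        where u = "\<lambda>(x, z). (g x, z)"] assms(2)
    by (simp add: split_beta)
  finally show ?thesis .
qed

subsection \<open>Distinct parts and finite sets\<close>

abbreviation partitions :: "parts set" where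
  "partitions \<equiv> {xs. sorted_wrt (\<ge>) xs}"

abbreviation distincts :: "parts set" where
  "distincts \<equiv> {xs. sorted_wrt (>) xs}"

text \<open>The binomial coefficient \<open>k\<close> over 2 at any integer \<open>k\<close>, the
  exponent of \<open>q\<close> in the theta series. Since \<open>k * (k - 1)\<close> is never
  negative, \<open>nat\<close> loses nothing for negative \<open>k\<close>.\<close>

definition tri :: "int \<Rightarrow> nat" where
  "tri k = nat (k * (k - 1) div 2)"

lemma two_tri: "2 * int (tri k) = k * (k - 1)"
proof -
  have "k * (k - 1) \<ge> 0"
    by (cases "k \<ge> 1") (auto simp: zero_le_mult_iff)
  moreover have "even (k * (k - 1))" by simp
  ultimately show ?thesis unfolding tri_def by auto
qed

lemma tri_0 [simp]: "tri 0 = 0"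
  by (simp add: tri_def)

lemma tri_Suc: "tri (1 + int n) = tri (int n) + n"
  using two_tri[of "int n"] two_tri[of "1 + int n"] by (simp add: algebra_simps)

text \<open>The predicate \<open>Q\<close> carries along side conditions on the parts, such as
  positivity or an upper bound.\<close>

lemma distincts_equiv_finite:
  "stat_equiv {xs \<in> distincts. Q (set xs)} (\<lambda>xs. (set xs, sum_list xs, length xs))
     {S. finite S \<and> Q S} (\<lambda>S. (S, \<Sum>S, card S))"
proof (rule stat_equivI[where h = set and h' = "\<lambda>S. rev (sorted_list_of_set S)"])
  fix xs :: parts assume "xs \<in> {xs \<in> distincts. Q (set xs)}"
  then have xs: "sorted_wrt (<) (rev xs)" "Q (set xs)" by (auto simp: sorted_wrt_rev)
  then show "rev (sorted_list_of_set (set xs)) = xs"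
    using sorted_list_of_set.idem_if_sorted_distinct[of "rev xs"]
    by (metis set_rev rev_rev_ident strict_sorted_iff)
  have "distinct xs" using xs(1) strict_sorted_iff distinct_rev by blast
  then show "(set xs, \<Sum>(set xs), card (set xs)) = (set xs, sum_list xs, length xs)"
    by (simp add: distinct_sum_list_conv_Sum distinct_card)
  show "set xs \<in> {S. finite S \<and> Q S}" using xs by simp
next
  fix S :: "nat set" assume "S \<in> {S. finite S \<and> Q S}"
  then show "rev (sorted_list_of_set S) \<in> {xs \<in> distincts. Q (set xs)}"
    "set (rev (sorted_list_of_set S)) = S"
    by (auto simp: sorted_wrt_rev)
qed

section \<open>The staircase shift between weak and strict decrease\<close>

primrec stair :: "parts \<Rightarrow> parts" where
  "stair [] = []"
| "stair (x # xs) = (x + length xs) # stair xs"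

primrec unstair :: "parts \<Rightarrow> parts" where
  "unstair [] = []"
| "unstair (x # xs) = (x - length xs) # unstair xs"

lemma length_stair [simp]: "length (stair xs) = length xs"
  by (induction xs) auto

lemma length_unstair [simp]: "length (unstair xs) = length xs"
  by (induction xs) auto

lemma unstair_stair: "unstair (stair xs) = xs"
  by (induction xs) auto

lemma sum_list_stair: "sum_list (stair xs) = sum_list xs + tri (int (length xs))"
  by (induction xs) (auto simp: tri_Suc)

lemma stair_less: "\<forall>p\<in>set xs. p \<le> x \<Longrightarrow> y \<in> set (stair xs) \<Longrightarrow> y < x + length xs"
  by (induction xs) auto

lemma distinct_stair: "sorted_wrt (\<ge>) xs \<Longrightarrow> sorted_wrt (>) (stair xs)"
  by (induction xs) (auto dest: stair_less)

text \<open>The parts after \<open>y\<close> are distinct naturals below \<open>y\<close>. Hence the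
  truncated subtraction in \<open>unstair\<close> is exact on strictly decreasing lists.\<close>

lemma length_le_of_distinct: "sorted_wrt (>) (y # ys) \<Longrightarrow> length ys \<le> (y::nat)"
  by (induction ys arbitrary: y) (auto simp: Suc_le_eq intro: le_less_trans)

lemma stair_unstair: "sorted_wrt (>) ys \<Longrightarrow> stair (unstair ys) = ys"
  using length_le_of_distinct by (induction ys) auto

lemma unstair_le: "sorted_wrt (>) (y # ys) \<Longrightarrow> p \<in> set (unstair ys) \<Longrightarrow> p \<le> y - length ys"
proof (induction ys arbitrary: y)
  case (Cons z zs)
  then show ?case using Cons.IH[of z] by fastforce
qed auto

lemma sorted_unstair: "sorted_wrt (>) ys \<Longrightarrow> sorted_wrt (\<ge>) (unstair ys)"
  using unstair_le by (induction ys) auto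

lemma partitions_equiv_distincts:
  "stat_equiv partitions (\<lambda>xs. (sum_list xs + tri (int (length xs)), length xs))
     distincts (\<lambda>xs. (sum_list xs, length xs))"
  by (rule stat_equivI[where h = stair and h' = unstair])
    (auto simp: unstair_stair stair_unstair distinct_stair sorted_unstair sum_list_stair)

lemma partitions_equiv_finite:
  "stat_equiv partitions (\<lambda>xs. (sum_list xs + tri (int (length xs)), length xs))
     {S. finite S} (\<lambda>S. (\<Sum>S, card S))"
proof -
  note partitions_equiv_distincts
  also have "stat_equiv distincts (\<lambda>xs. (sum_list xs, length xs)) {S. finite S} (\<lambda>S. (\<Sum>S, card S))"
    using stat_equiv_map[OF distincts_equiv_finite[of "\<lambda>_. True"], where u = snd] by simp
  finally show ?thesis .
qed



subsection \<open>The coefficients of the theta quotient\<close>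

lemma reflect_lessThan: "(\<lambda>x. N - 1 - x) ` (\<lambda>x. N - 1 - x) ` X = X" if "X \<subseteq> {..<N}" for N :: nat
proof -
  have "(\<lambda>x. N - 1 - (N - 1 - x)) ` X = (\<lambda>x. x) ` X"
    by (rule image_cong) (use that in auto)
  then show ?thesis by (simp add: image_image)
qed

text \<open>The complement of a subset of \<open>{..<N}\<close>, reflected, and a set shifted past \<open>N\<close> together make up
  an arbitrary finite set.\<close>

lemma finite_sets_cut:
  fixes N :: nat
  shows "stat_equiv ({S. finite S \<and> 0 \<notin> S} \<times> {K. K \<subseteq> {..<N}})
      (\<lambda>(S, K). (\<Sum>S + \<Sum>K, int (card K) - int (card S)))
    {U. finite U}
      (\<lambda>U. (nat (int (\<Sum>U) + int (tri (int N - int (card U))) - int (tri (int (card U)))), int N - int (card U)))"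
proof (rule stat_equivI[where h = "\<lambda>(S, K). (\<lambda>x. N - 1 - x) ` ({..<N} - K) \<union> (\<lambda>x. N + x - 1) ` S"
      and h' = "\<lambda>U. ((\<lambda>x. x + 1 - N) ` (U - {..<N}), {..<N} - (\<lambda>x. N - 1 - x) ` (U \<inter> {..<N}))"])
  fix x :: "nat set \<times> nat set"
  assume "x \<in> {S. finite S \<and> 0 \<notin> S} \<times> {K. K \<subseteq> {..<N}}"
  then obtain S K where x: "x = (S, K)" and S: "finite S" "0 \<notin> S" and K: "K \<subseteq> {..<N}"
    by auto
  define L where "L = (\<lambda>x. N - 1 - x) ` ({..<N} - K)"
  define R where "R = (\<lambda>x. N + x - 1) ` S"
  \<comment> \<open>Excluding 0 from \<open>S\<close> is what puts \<open>N + s - 1\<close> at or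
    above \<open>N\<close>, with 1 going to \<open>N\<close> itself, so the images of
    \<open>S\<close> and of the complement of \<open>K\<close> cannot meet.\<close>
  have S1: "1 \<le> s" if "s \<in> S" for s
    using that S(2) by (cases s) auto
  have L: "L \<subseteq> {..<N}" "finite L" unfolding L_def by auto
  have R: "R \<inter> {..<N} = {}" "finite R"
    unfolding R_def using S1 S by fastforce+
  have LR: "(L \<union> R) - {..<N} = R" "(L \<union> R) \<inter> {..<N} = L"
    using L R by auto
  have injL: "inj_on (\<lambda>x. N - 1 - x) ({..<N} - K)"
    by (auto simp: inj_on_def)
  have injR: "inj_on (\<lambda>x. N + x - 1) S"
  proof (rule inj_onI)
    fix s t assume "s \<in> S" "t \<in> S" "N + s - 1 = N + t - 1"
    then show "s = t" using S1[of s] S1[of t] by linarith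
  qed
  have "(\<lambda>x. x + 1 - N) ` R = (\<lambda>x. x) ` S"
    unfolding R_def image_image by (rule image_cong) (use S1 in fastforce)+
  moreover have "{..<N} - (\<lambda>x. N - 1 - x) ` L = K"
    unfolding L_def by (subst reflect_lessThan) (use K in auto)
  ultimately show "(\<lambda>U. ((\<lambda>x. x + 1 - N) ` (U - {..<N}), {..<N} - (\<lambda>x. N - 1 - x) ` (U \<inter> {..<N})))
      ((\<lambda>(S, K). (\<lambda>x. N - 1 - x) ` ({..<N} - K) \<union> (\<lambda>x. N + x - 1) ` S) x) = x"
    by (simp only: x prod.case L_def[symmetric] R_def[symmetric] LR image_ident)
  show "(\<lambda>(S, K). (\<lambda>x. N - 1 - x) ` ({..<N} - K) \<union> (\<lambda>x. N + x - 1) ` S) x \<in> {U. finite U}"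
    using S by (simp add: x)
  have fK: "finite K" using K finite_subset by blast
  have cL: "card L = N - card K" unfolding L_def card_image[OF injL]
    by (simp add: card_Diff_subset fK K)
  have kN: "card K \<le> N" using card_mono[OF _ K] by simp
  have cR: "card R = card S" unfolding R_def by (rule card_image[OF injR])
  have disj: "L \<inter> R = {}" using L R by auto
  have c: "int (card (L \<union> R)) = int N - int (card K) + int (card S)"
    using kN by (simp add: card_Un_disjoint L R disj cL cR)
  have "\<Sum>L = (\<Sum>x\<in>{..<N} - K. N - 1 - x)"
    unfolding L_def sum.reindex[OF injL] by simp
  also have "int \<dots> = (\<Sum>x\<in>{..<N} - K. (int N - 1) - int x)"
    unfolding of_nat_sum by (rule sum.cong) auto
  also have "\<dots> = (\<Sum>x\<in>{..<N}. (int N - 1) - int x) - (\<Sum>x\<in>K. (int N - 1) - int x)"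
    by (rule sum_diff) (use K in auto)
  also have "(\<Sum>x\<in>{..<N}. (int N - 1) - int x) = int (\<Sum>{..<N})"
    using sum.nat_diff_reindex[of int N] by (simp add: of_nat_diff algebra_simps)
  also have "(\<Sum>x\<in>K. (int N - 1) - int x) = int (card K) * (int N - 1) - int (\<Sum>K)"
    by (simp add: sum_subtractf)
  finally have "int (\<Sum>L) = int (\<Sum>{..<N}) - (int (card K) * (int N - 1) - int (\<Sum>K))" .
  moreover have "2 * int (\<Sum>{..<N}) = int N * (int N - 1)"
    by (induction N) (auto simp: algebra_simps)
  ultimately have sL: "2 * int (\<Sum>L) = int N * (int N - 1) - 2 * int (card K) * (int N - 1) + 2 * int (\<Sum>K)"
    by (simp only:) (simp add: algebra_simps)
  have "\<Sum>R = (\<Sum>x\<in>S. N + x - 1)"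
    unfolding R_def sum.reindex[OF injR] by simp
  also have "int \<dots> = (\<Sum>x\<in>S. (int N - 1) + int x)"
    unfolding of_nat_sum by (rule sum.cong) (use S1 in force)+
  finally have sR: "int (\<Sum>R) = int (card S) * (int N - 1) + int (\<Sum>S)"
    by (simp add: sum.distrib)
  have "\<Sum>(L \<union> R) = \<Sum>L + \<Sum>R" by (rule sum.union_disjoint) (use L R disj in auto)
  \<comment> \<open>With \<open>k = card K - card S\<close> the union has \<open>N - k\<close>
    elements, and its weight exceeds that of \<open>S\<close> and \<open>K\<close> together by
    \<open>tri N - k * (N - 1)\<close>, which equals \<open>tri (N - k) - tri k\<close>. Doubling
    avoids the division in \<open>tri\<close>.\<close>
  then have "2 * (int (\<Sum>(L \<union> R)) + int (tri (int N - int (card (L \<union> R)))) - int (tri (int (card (L \<union> R)))))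
      = 2 * (int (\<Sum>S) + int (\<Sum>K))"
    unfolding c of_nat_add distrib_left right_diff_distrib two_tri
    using sL sR by (simp add: algebra_simps)
  then have "int (\<Sum>(L \<union> R)) + int (tri (int N - int (card (L \<union> R)))) - int (tri (int (card (L \<union> R))))
      = int (\<Sum>S + \<Sum>K)" "int N - int (card (L \<union> R)) = int (card K) - int (card S)"
    using c by simp_all
  then show "(\<lambda>U. (nat (int (\<Sum>U) + int (tri (int N - int (card U))) - int (tri (int (card U)))),
        int N - int (card U)))
      ((\<lambda>(S, K). (\<lambda>x. N - 1 - x) ` ({..<N} - K) \<union> (\<lambda>x. N + x - 1) ` S) x) =
     (\<lambda>(S, K). (\<Sum>S + \<Sum>K, int (card K) - int (card S))) x"
    by (simp only: x prod.case L_def[symmetric] R_def[symmetric] nat_int)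
next
  fix U :: "nat set" assume "U \<in> {U. finite U}"
  then have U: "finite U" by simp
  have "0 \<notin> (\<lambda>x. x + 1 - N) ` (U - {..<N})" by auto
  then show "((\<lambda>x. x + 1 - N) ` (U - {..<N}), {..<N} - (\<lambda>x. N - 1 - x) ` (U \<inter> {..<N})) \<in>
      {S. finite S \<and> 0 \<notin> S} \<times> {K. K \<subseteq> {..<N}}"
    using U by auto
  have "{..<N} - ({..<N} - (\<lambda>x. N - 1 - x) ` (U \<inter> {..<N})) = (\<lambda>x. N - 1 - x) ` (U \<inter> {..<N})"
    by auto
  then have "(\<lambda>x. N - 1 - x) ` ({..<N} - ({..<N} - (\<lambda>x. N - 1 - x) ` (U \<inter> {..<N}))) = U \<inter> {..<N}"
    using reflect_lessThan[of "U \<inter> {..<N}" N] by simp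
  moreover have "(\<lambda>x. N + x - 1) ` (\<lambda>x. x + 1 - N) ` (U - {..<N}) = (\<lambda>x. x) ` (U - {..<N})"
    unfolding image_image by (rule image_cong) auto
  ultimately show "(\<lambda>(S, K). (\<lambda>x. N - 1 - x) ` ({..<N} - K) \<union> (\<lambda>x. N + x - 1) ` S)
      ((\<lambda>x. x + 1 - N) ` (U - {..<N}), {..<N} - (\<lambda>x. N - 1 - x) ` (U \<inter> {..<N})) = U"
    by auto
qed


text \<open>Stripping the staircase from the finite set \<open>U\<close> cancels
  \<open>tri (card U)\<close> in \<open>finite_sets_cut\<close>. In generating functions:
  \<open>(-q/a; q)_inf (-a; q)_N\<close> is the sum over \<open>p\<close> of
  \<open>a^(N-p) q^(tri (N-p)) / (q; q)_p\<close>.\<close>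

lemma cut_partitions:
  "stat_equiv ({\<alpha> \<in> distincts. 0 \<notin> set \<alpha>} \<times> {\<kappa> \<in> distincts. set \<kappa> \<subseteq> {..<N}})
     (\<lambda>(\<alpha>, \<kappa>). (sum_list \<alpha> + sum_list \<kappa>, int (length \<kappa>) - int (length \<alpha>)))
   partitions (\<lambda>P. (sum_list P + tri (int N - int (length P)), int N - int (length P)))"
  (is "stat_equiv ?X ?f partitions ?g")
proof -
  have K: "{S. finite S \<and> S \<subseteq> {..<N}} = {S. S \<subseteq> {..<N}}" 
    by (auto intro: finite_subset)
  have "stat_equiv ?X ?f ({S. finite S \<and> 0 \<notin> S} \<times> {K. K \<subseteq> {..<N}})
      (\<lambda>(S, K). (\<Sum>S + \<Sum>K, int (card K) - int (card S)))"
    unfolding K[symmetric]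
    by (rule stat_equiv_map[OF stat_equiv_Times[OF distincts_equiv_finite distincts_equiv_finite],
        where u = "\<lambda>((S, s, c), (S', s', c')). (s + s', int c' - int c)"]) auto
  also note finite_sets_cut
  also have "stat_equiv {U. finite U}
      (\<lambda>U. (nat (int (\<Sum>U) + int (tri (int N - int (card U))) - int (tri (int (card U)))), int N - int (card U)))
      partitions ?g"
    by (rule stat_equiv_map[OF stat_equiv_sym[OF partitions_equiv_finite],
        where u = "\<lambda>(s, c). (nat (int s + int (tri (int N - int c)) - int (tri (int c))), int N - int c)"]) auto
  finally show ?thesis .
qed

section \<open>The Jacobi triple product as a limit\<close>

lemma tri_ge: "k - 1 \<le> int (tri k)"
proof -
  have "0 \<le> (k - 1) * (k - 2)"
    by (cases "k \<ge> 2"; cases "k \<le> 1") (auto simp: zero_le_mult_iff)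
  then show ?thesis using two_tri[of k] by (simp add: algebra_simps)
qed

text \<open>In a weakly decreasing list the zeros come last, so a partition is determined by its
  length and its positive parts.\<close>

lemma pad_filter_pos:
  fixes P :: parts
  assumes "sorted_wrt (\<ge>) P"
  shows "filter ((<) 0) P @ replicate (length P - length (filter ((<) 0) P)) 0 = P"
  using assms
proof (induction P)
  case (Cons p P)
  show ?case
  proof (cases "p = 0")
    case True
    with Cons.prems have "set (p # P) \<subseteq> {0}" by auto
    then have "filter ((<) 0) (p # P) = []" "replicate (length (p # P)) 0 = p # P"
      by (auto simp: filter_empty_conv intro!: replicate_eqI[symmetric])
    then show ?thesis by simp
  next
    case False
    with Cons show ?thesis by simp
  qed
qed simp

lemma sum_list_filter_pos: "sum_list (filter ((<) 0) P) = sum_list (P :: parts)"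
  by (induction P) auto

lemma sorted_wrt_replicate: "sorted_wrt (\<ge>) (replicate n (x::nat))"
  by (induction n) auto

lemma length_le_sum_list: "0 \<notin> set P \<Longrightarrow> length P \<le> sum_list (P :: parts)"
  by (induction P) auto

text \<open>The limit \<open>N \<rightarrow> \<infinity>\<close> of \<open>cut_partitions\<close>.\<close>

lemma jacobi_triple_product:
  "stat_equiv ({\<alpha> \<in> distincts. 0 \<notin> set \<alpha>} \<times> distincts)
     (\<lambda>(\<alpha>, \<kappa>). (sum_list \<alpha> + sum_list \<kappa>, int (length \<kappa>) - int (length \<alpha>)))
   (UNIV \<times> {\<beta> \<in> partitions. 0 \<notin> set \<beta>}) (\<lambda>(k, \<beta>). (sum_list \<beta> + tri k, k))"
  (is "stat_equiv ?X ?f ?Y ?g")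
proof (rule stat_equiv_fibres)
  fix v :: "nat \<times> int"
  obtain w k where v: "v = (w, k)" by fastforce
  \<comment> \<open>In a fibre of weight \<open>w\<close> no part of \<kappa> exceeds
    \<open>w\<close>. With this \<open>N\<close> the bound in \<open>cut_partitions\<close> is
    automatic and the fibre is already the limiting one.\<close>
  define N where "N = Suc w"
  let ?XN = "{\<alpha> \<in> distincts. 0 \<notin> set \<alpha>} \<times> {\<kappa> \<in> distincts. set \<kappa> \<subseteq> {..<N}}"
  let ?P = "{P \<in> partitions. (sum_list P + tri (int N - int (length P)), int N - int (length P)) = v}"
  have X: "{x \<in> ?X. ?f x = v} = {x \<in> ?XN. ?f x = v}"
    unfolding v N_def by (fastforce simp: lessThan_Suc_atMost dest: member_le_sum_list)
  have "stat_equiv {x \<in> ?X. ?f x = v} ?f ?P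
      (\<lambda>P. (sum_list P + tri (int N - int (length P)), int N - int (length P)))"
    unfolding X by (rule stat_equiv_Collect[OF cut_partitions])
  \<comment> \<open>In the fibre the length of \<open>P\<close> is fixed at \<open>N - k\<close>, so
    only the positive parts of \<open>P\<close> carry information.\<close>
  also have "stat_equiv ?P (\<lambda>P. (sum_list P + tri (int N - int (length P)), int N - int (length P)))
      {y \<in> ?Y. ?g y = v} ?g"
  proof (rule stat_equivI[where h = "\<lambda>P. (k, filter ((<) 0) P)"
        and h' = "\<lambda>(k, \<beta>). \<beta> @ replicate (nat (int N - k) - length \<beta>) 0"], goal_cases)
    case (1 P)
    then show ?case by (auto simp: v sum_list_filter_pos sorted_wrt_filter)
  next
    case (2 P)
    then have "nat (int N - k) = length P" by (auto simp: v)
    with 2 show ?case using pad_filter_pos[of P] by simp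
  next
    case (3 P)
    then show ?case by (auto simp: v sum_list_filter_pos)
  next
    case (4 y)
    then obtain \<beta> where y: "y = (k, \<beta>)" "\<beta> \<in> partitions" "0 \<notin> set \<beta>" "sum_list \<beta> + tri k = w"
      by (auto simp: v)
    \<comment> \<open>There is room for the padding: a partition into positive parts has at most as
      many parts as its weight \<open>w - tri k\<close>, and this is at most
      \<open>w + 1 - k\<close> by \<open>tri_ge\<close>.\<close>
    have "int (length \<beta>) \<le> int N - k"
      using length_le_sum_list[OF y(3)] y(4) tri_ge[of k] by (simp add: N_def)
    then have "int (length \<beta> + (nat (int N - k) - length \<beta>)) = int N - k" by simp
    with y show ?case
      by (auto simp: v sorted_wrt_append sorted_wrt_replicate sum_list_replicate)
  next
    case (5 y)
    then obtain \<beta> where y: "y = (k, \<beta>)" "0 \<notin> set \<beta>" by (auto simp: v)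
    then have "filter ((<) 0) \<beta> = \<beta>" by (auto simp: filter_id_conv intro: gr0I)
    with y show ?case by simp
  qed
  finally show "stat_equiv {x \<in> ?X. ?f x = v} ?f {y \<in> ?Y. ?g y = v} ?g" .
qed

text \<open>The coefficient of \<open>z\<^sup>N\<close> in \<open>(- a z; q)\<^sub>\<infinity> (- q/(a z); q)\<^sub>\<infinity> / (z; q)\<^sub>\<infinity>\<close> is
  \<open>(- a; q)\<^sub>N (- q/a; q)\<^sub>\<infinity> / (q; q)\<^sub>\<infinity>\<close>.\<close>

lemma theta_quotient:
  "stat_equiv ({\<alpha> \<in> distincts. 0 \<notin> set \<alpha>} \<times> {\<beta> \<in> partitions. 0 \<notin> set \<beta>} \<times> {\<kappa> \<in> distincts. set \<kappa> \<subseteq> {..<N}})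
     (\<lambda>(\<alpha>, \<beta>, \<kappa>). (sum_list \<alpha> + sum_list \<beta> + sum_list \<kappa>, int (length \<kappa>) - int (length \<alpha>)))
   {(C, D, E). C \<in> distincts \<and> D \<in> partitions \<and> E \<in> distincts \<and> 0 \<notin> set E \<and>
      int (length C) + int (length D) - int (length E) = int N}
     (\<lambda>(C, D, E). (sum_list C + sum_list D + sum_list E, int (length C) - int (length E)))"
  (is "stat_equiv (?D \<times> ?B \<times> ?K) ?f ?Y ?g")
proof -
  let ?J = "\<lambda>(\<alpha>, \<kappa>). (sum_list \<alpha> + sum_list \<kappa>, int (length \<kappa>) - int (length \<alpha>))"
  let ?S1 = "SIGMA x: UNIV \<times> ?B. {P \<in> partitions. int N - int (length P) = snd ((\<lambda>(k, \<beta>). (sum_list \<beta> + tri k, k)) x)}"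
  let ?S2 = "SIGMA x: ?D \<times> distincts. {P \<in> partitions. int N - int (length P) = snd (?J x)}"
  have "stat_equiv (?D \<times> ?B \<times> ?K) ?f ((?D \<times> ?K) \<times> ?B) (\<lambda>((\<alpha>, \<kappa>), \<beta>). ?f (\<alpha>, \<beta>, \<kappa>))"
    by (rule stat_equivI[where h = "\<lambda>(\<alpha>, \<beta>, \<kappa>). ((\<alpha>, \<kappa>), \<beta>)" and h' = "\<lambda>((\<alpha>, \<kappa>), \<beta>). (\<alpha>, \<beta>, \<kappa>)"]) auto
  also have "stat_equiv ((?D \<times> ?K) \<times> ?B) (\<lambda>((\<alpha>, \<kappa>), \<beta>). ?f (\<alpha>, \<beta>, \<kappa>))
      (partitions \<times> ?B)
      (\<lambda>(P, \<beta>). (sum_list P + tri (int N - int (length P)) + sum_list \<beta>, int N - int (length P)))"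
    by (rule stat_equiv_map[OF stat_equiv_Times[OF cut_partitions stat_equiv_refl[where f = sum_list and g = sum_list]],
          where u = "\<lambda>((w, k), s). (w + s, k)"]) auto
  \<comment> \<open>Put \<open>k = N - length P\<close>. The term \<open>tri k\<close> in the weight
    then combines with \<beta> into one side of the triple product, while \<open>P\<close> stays
    behind and will be \<open>D\<close>.\<close>
  also have "stat_equiv (partitions \<times> ?B)
      (\<lambda>(P, \<beta>). (sum_list P + tri (int N - int (length P)) + sum_list \<beta>, int N - int (length P)))
      ?S1
      (\<lambda>((k, \<beta>), P). (sum_list \<beta> + tri k + sum_list P, k))"
    by (rule stat_equivI[where h = "\<lambda>(P, \<beta>). ((int N - int (length P), \<beta>), P)" and h' = "\<lambda>((k, \<beta>), P). (P, \<beta>)"])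
      auto
  \<comment> \<open>Which \<open>P\<close> are admissible depends on \<open>k\<close> alone. After
    the triple product \<open>k\<close> is \<open>length C - length E\<close>, which turns the
    constraint on \<open>length P\<close> into the one defining the target.\<close>
  also have "stat_equiv ?S1 (\<lambda>((k, \<beta>), P). (sum_list \<beta> + tri k + sum_list P, k))
      ?S2
      (\<lambda>((E, C), D). ?g (C, D, E))"
    by (rule stat_equiv_map[OF stat_equiv_Sigma_base[OF stat_equiv_sym[OF jacobi_triple_product]],
          where u = "\<lambda>((w, k), P). (w + sum_list P, k)"]) auto
  also have "stat_equiv ?S2 (\<lambda>((E, C), D). ?g (C, D, E)) ?Y ?g"
    by (rule stat_equivI[where h = "\<lambda>((E, C), D). (C, D, E)" and h' = "\<lambda>(C, D, E). ((E, C), D)"]) auto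
  finally show ?thesis .
qed

subsection \<open>The summation over the length of \<open>\<gamma>\<close>\<close>

text \<open>With \<open>j\<close> the least index at which \<open>B ! j < c + j\<close>, or
  \<open>length B\<close> if there is none, the diagram of \<open>B\<close> contains the rectangle
  of \<open>j\<close> rows and \<open>c + j - 1\<close> columns. \<open>P\<close> is what lies to
  its right and \<mu> what lies below. For \<open>j = 0\<close> the truncated width is harmless
  because there are no rows.\<close>

lemma durfee_rectangle:
  "stat_equiv (SIGMA P:partitions. {\<mu> \<in> partitions. set \<mu> \<subseteq> {..<c + length P}})
     (\<lambda>(P, \<mu>). (sum_list P + length P * (c + length P - 1) + sum_list \<mu>, length P + length \<mu>))
   partitions (\<lambda>B. (sum_list B, length B))"
proof (rule stat_equivI[where h = "\<lambda>(P, \<mu>). map (\<lambda>x. x + (c + length P - 1)) P @ \<mu>"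
      and h' = "\<lambda>B. let j = (LEAST j. j < length B \<longrightarrow> B ! j < c + j)
                  in (map (\<lambda>x. x - (c + j - 1)) (take j B), drop j B)"], goal_cases)
  case (1 x)
  then show ?case by (fastforce simp: sorted_wrt_append sorted_wrt_map)
next
  case (2 x)
  then obtain P \<mu> where x: "x = (P, \<mu>)" "set \<mu> \<subseteq> {..<c + length P}" by blast
  let ?B = "map (\<lambda>x. x + (c + length P - 1)) P @ \<mu>"
  have "(LEAST j. j < length ?B \<longrightarrow> ?B ! j < c + j) = length P"
  proof (rule Least_equality)
    show "length P < length ?B \<longrightarrow> ?B ! length P < c + length P"
      using subsetD[OF x(2) nth_mem[of 0 \<mu>]] by (auto simp: nth_append)
    \<comment> \<open>An index inside \<open>P\<close> cannot qualify: its entry is at least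
      \<open>c + length P - 1\<close>, hence at least \<open>c + j\<close>.\<close>
    fix j assume j: "j < length ?B \<longrightarrow> ?B ! j < c + j"
    show "length P \<le> j"
    proof (rule ccontr)
      assume "\<not> length P \<le> j"
      with j show False by (simp add: nth_append)
    qed
  qed
  then show ?case by (simp add: x Let_def comp_def)
next
  case (3 x)
  then show ?case by (auto simp: sum_list_addf sum_list_triv)
next
  case (4 B)
  define j where "j = (LEAST j. j < length B \<longrightarrow> B ! j < c + j)"
  have B: "sorted_wrt (\<ge>) B" using 4 by simp
  \<comment> \<open>The condition holds vacuously at \<open>length B\<close>, so a least index
    exists even when no part falls below its threshold.\<close>
  have j: "j < length B \<longrightarrow> B ! j < c + j"
    unfolding j_def by (rule LeastI[of _ "length B"]) simp
  have jl: "j \<le> length B" unfolding j_def by (rule Least_le) simp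
  have "y < c + j" if "y \<in> set (drop j B)" for y
  proof -
    from that obtain t where t: "t < length B - j" "y = B ! (j + t)"
      by (auto simp: in_set_conv_nth)
    have "y \<le> B ! j" using B t by (cases "t = 0") (auto simp: sorted_wrt_iff_nth_less)
    with j t show ?thesis by linarith
  qed
  then show ?case using B jl unfolding Let_def j_def[symmetric]
    by (auto simp: sorted_wrt_map sorted_wrt_take sorted_wrt_drop
        intro!: sorted_wrt_mono_rel[OF _ sorted_wrt_take[OF B]])
next
  case (5 B)
  define j where "j = (LEAST j. j < length B \<longrightarrow> B ! j < c + j)"
  have B: "sorted_wrt (\<ge>) B" using 5 by simp
  have jl: "j \<le> length B" unfolding j_def by (rule Least_le) simp
  have ge: "c + j - 1 \<le> y" if "y \<in> set (take j B)" for y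
  proof -
    from that obtain t where t: "t < j" "t < length B" "y = B ! t"
      by (auto simp: in_set_conv_nth)
    \<comment> \<open>Minimality of \<open>j\<close> bounds only the last row of the rectangle from
      below; the earlier rows follow since \<open>B\<close> is weakly decreasing.\<close>
    have "j - 1 < j" using t by simp
    then have "\<not> (j - 1 < length B \<longrightarrow> B ! (j - 1) < c + (j - 1))"
      unfolding j_def by (rule not_less_Least)
    then have "c + (j - 1) \<le> B ! (j - 1)" by simp
    also have "\<dots> \<le> y"
      using B t jl by (cases "t = j - 1") (auto simp: sorted_wrt_iff_nth_less)
    finally show ?thesis using t by simp
  qed
  have "map (\<lambda>x. x - (c + j - 1) + (c + j - 1)) (take j B) = take j B"
    by (rule map_idI) (use ge in fastforce)
  moreover have "length (take j B) = j" using jl by simp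
  ultimately have "map (\<lambda>x. x + (c + length (map (\<lambda>x. x - (c + j - 1)) (take j B)) - 1))
      (map (\<lambda>x. x - (c + j - 1)) (take j B)) @ drop j B = B"
    unfolding length_map map_map comp_def by (simp only: append_take_drop_id)
  then show ?case unfolding Let_def j_def[symmetric] prod.case .
qed

section \<open>Ranks and gaps in a finite set\<close>

definition rank_above :: "nat set \<Rightarrow> nat \<Rightarrow> nat" where
  "rank_above S g = card {x \<in> S. g < x}"

text \<open>The rank is strictly decreasing on \<open>S\<close> and stays below
  \<open>card S\<close>, so surjectivity follows by counting.\<close>

lemma rank_above_bij:
  assumes "finite S"
  shows "bij_betw (rank_above S) S {..<card S}"
proof -
  have less: "rank_above S y < rank_above S x" if "x < y" "y \<in> S" for x y
    unfolding rank_above_def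
    by (rule psubset_card_mono) (use that assms in auto)
  have inj: "inj_on (rank_above S) S"
    by (rule inj_onI) (metis less less_irrefl nat_neq_iff)
  have "rank_above S ` S \<subseteq> {..<card S}"
    unfolding rank_above_def using assms by (auto intro!: psubset_card_mono)
  moreover have "card (rank_above S ` S) = card {..<card S}"
    using card_image[OF inj] by simp
  ultimately have "rank_above S ` S = {..<card S}" by (intro card_subset_eq) auto
  with inj show ?thesis unfolding bij_betw_def by blast
qed

lemma tri_eq_sum: "tri (int n) = \<Sum>{..<n}"
  by (induction n) (auto simp: tri_Suc add.commute)

lemma sum_rank_above:
  assumes "finite G" shows "sum (rank_above G) G = tri (int (card G))"
  using sum.reindex_bij_betw[OF rank_above_bij[OF assms], of "\<lambda>x. x"] by (simp add: tri_eq_sum)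

lemma rank_above_Un:
  assumes "finite A" "finite G" "A \<inter> G = {}"
  shows "rank_above (A \<union> G) x = rank_above A x + rank_above G x"
proof -
  have "{y \<in> A \<union> G. x < y} = {y \<in> A. x < y} \<union> {y \<in> G. x < y}" by auto
  then show ?thesis unfolding rank_above_def using assms by (simp add: card_Un_disjoint disjoint_iff)
qed

text \<open>A part \<open>N + r\<close> of the second partition marks the element of \<open>\<Gamma>\<close> that has \<open>r\<close> larger elements;
  \<open>G\<close> is the set of marked elements and \<open>A\<close> that of unmarked ones.\<close>

lemma mark_by_rank:
  fixes N :: nat
  shows "stat_equiv (SIGMA \<Gamma>:{S. finite S}. {K. K \<subseteq> {..<N + card \<Gamma>}})
      (\<lambda>(\<Gamma>, K). (\<Sum>\<Gamma> + \<Sum>K, card \<Gamma>, card K))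
    (SIGMA x:{K. K \<subseteq> {..<N}} \<times> {A. finite A}. {G. finite G \<and> snd x \<inter> G = {}})
      (\<lambda>((K, A), G). (\<Sum>K + \<Sum>A + (\<Sum>g\<in>G. g + rank_above A g) + tri (int (card G)) + N * card G,
         card A + card G, card K + card G))"
proof (rule stat_equiv_sym, rule stat_equivI[where h = "\<lambda>((K, A), G). (A \<union> G, K \<union> (\<lambda>g. N + rank_above (A \<union> G) g) ` G)"
      and h' = "\<lambda>(\<Gamma>, K). ((K \<inter> {..<N}, {g \<in> \<Gamma>. N + rank_above \<Gamma> g \<notin> K}), {g \<in> \<Gamma>. N + rank_above \<Gamma> g \<in> K})"],
      goal_cases)
  case (1 x)
  then obtain K A G where x: "x = ((K, A), G)" and K: "K \<subseteq> {..<N}"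
    and A: "finite A" "finite G" "A \<inter> G = {}" by auto
  have "rank_above (A \<union> G) g < card (A \<union> G)" if "g \<in> G" for g
    using bij_betwE[OF rank_above_bij[of "A \<union> G"]] A that by auto
  with x K A show ?case by fastforce
next
  case (2 x)
  then obtain K A G where x: "x = ((K, A), G)" and K: "K \<subseteq> {..<N}"
    and A: "finite A" "finite G" "A \<inter> G = {}" by auto
  have inj: "inj_on (rank_above (A \<union> G)) (A \<union> G)"
    using rank_above_bij[of "A \<union> G"] A by (simp add: bij_betw_def)
  \<comment> \<open>The marks can be read back: \<open>K\<close> lies below \<open>N\<close>, and
    distinct elements have distinct ranks.\<close>
  have "N + rank_above (A \<union> G) g \<in> K \<union> (\<lambda>g. N + rank_above (A \<union> G) g) ` G \<longleftrightarrow> g \<in> G"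
    if "g \<in> A \<union> G" for g
    using K inj_on_image_mem_iff[OF inj that, of G] by (auto simp: image_iff)
  then show ?case using K A x by auto
next
  case (3 x)
  then obtain K A G where x: "x = ((K, A), G)" and K: "K \<subseteq> {..<N}"
    and A: "finite A" "finite G" "A \<inter> G = {}" by auto
  let ?r = "\<lambda>g. N + rank_above (A \<union> G) g"
  have fK: "finite K" using K finite_subset by blast
  have inj: "inj_on ?r G"
    using rank_above_bij[of "A \<union> G"] A by (auto simp: bij_betw_def inj_on_def)
  have disj: "K \<inter> ?r ` G = {}" using K by auto
  have "\<Sum>(K \<union> ?r ` G) = \<Sum>K + \<Sum>(?r ` G)"
    by (rule sum.union_disjoint) (use fK A disj in auto)
  \<comment> \<open>The rank in the union splits into ranks in \<open>A\<close> and in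
    \<open>G\<close>. The latter run through all numbers below \<open>card G\<close>, which is where
    \<open>tri (card G)\<close> comes from.\<close>
  also have "\<Sum>(?r ` G) = (\<Sum>g\<in>G. N + (rank_above A g + rank_above G g))"
    unfolding sum.reindex[OF inj] by (simp add: rank_above_Un A)
  finally have s: "\<Sum>(K \<union> ?r ` G) = \<Sum>K + sum (rank_above A) G + tri (int (card G)) + N * card G"
    by (simp add: sum.distrib sum_rank_above A)
  have c: "card (K \<union> ?r ` G) = card K + card G"
    by (simp add: card_Un_disjoint fK A disj card_image[OF inj])
  have "\<Sum>(A \<union> G) = \<Sum>A + \<Sum>G" by (rule sum.union_disjoint) (use A in auto)
  then show ?case by (simp add: x s c card_Un_disjoint A sum.distrib)
next
  case (4 y)
  then show ?case by auto
next
  case (5 y)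
  then obtain \<Gamma> K where y: "y = (\<Gamma>, K)" and \<Gamma>: "finite \<Gamma>" and K: "K \<subseteq> {..<N + card \<Gamma>}" by auto
  \<comment> \<open>Ranks exhaust the numbers below \<open>card \<Gamma>\<close>, so every part of
    \<open>K\<close> from \<open>N\<close> on marks some element.\<close>
  have "\<exists>g\<in>\<Gamma>. k = N + rank_above \<Gamma> g" if "k \<in> K" "\<not> k < N" for k
  proof -
    have "k - N \<in> {..<card \<Gamma>}" using that K by (auto simp: subset_iff)
    then have "k - N \<in> rank_above \<Gamma> ` \<Gamma>" using rank_above_bij[OF \<Gamma>] by (simp add: bij_betw_def)
    then show ?thesis using that by force
  qed
  moreover have "{g \<in> \<Gamma>. N + rank_above \<Gamma> g \<notin> K} \<union> {g \<in> \<Gamma>. N + rank_above \<Gamma> g \<in> K} = \<Gamma>" by blast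
  ultimately show ?case by (auto simp: y)
qed

text \<open>The gap with index \<open>n\<close>, counted from 0, is \<open>n\<close> plus the number
  of elements of \<open>A\<close> below it; its rank counts those above. Together these are all of
  \<open>A\<close>. This is why ranks are counted from the top.\<close>

lemma enumerate_gaps:
  assumes "finite A"
  shows "enumerate (- A) n + rank_above A (enumerate (- A) n) = n + card A"
proof -
  let ?e = "enumerate (- A)"
  have inf: "infinite (- A)" using assms by simp
  let ?g = "?e n"
  have g: "?g \<notin> A" using enumerate_in_set[OF inf, of n] by simp
  have "{x. x \<notin> A \<and> x < ?g} = ?e ` {..<n}"
  proof (intro set_eqI iffI)
    fix x assume x: "x \<in> {x. x \<notin> A \<and> x < ?g}"
    then obtain k where k: "x = ?e k" using enumerate_Ex[OF inf, of x] by auto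
    with x have "k < n" using enumerate_mono_iff[OF inf] by auto
    with k show "x \<in> ?e ` {..<n}" by blast
  next
    fix x assume "x \<in> ?e ` {..<n}"
    then show "x \<in> {x. x \<notin> A \<and> x < ?g}"
      using enumerate_in_set[OF inf] enumerate_mono_iff[OF inf] by auto
  qed
  then have n: "card {x. x \<notin> A \<and> x < ?g} = n"
    by (simp add: card_image[OF inj_on_subset[OF inj_enumerate[OF inf]]])
  have "{..<?g} = {x. x \<notin> A \<and> x < ?g} \<union> {x \<in> A. x < ?g}" by auto
  then have "card {..<?g} = card ({x. x \<notin> A \<and> x < ?g} \<union> {x \<in> A. x < ?g})" by simp
  also have "\<dots> = n + card {x \<in> A. x < ?g}"
    by (subst card_Un_disjoint) (use assms n in auto)
  finally have 1: "?g = n + card {x \<in> A. x < ?g}" by simp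
  have "A = {x \<in> A. x < ?g} \<union> {x \<in> A. ?g < x}" using g by (auto, metis linorder_neqE_nat)
  then have "card A = card ({x \<in> A. x < ?g} \<union> {x \<in> A. ?g < x})" by simp
  also have "\<dots> = card {x \<in> A. x < ?g} + rank_above A ?g"
    unfolding rank_above_def by (rule card_Un_disjoint) (use assms in auto)
  finally show ?thesis using 1 by simp
qed

text \<open>Each element of \<open>G\<close> is replaced by its index among the gaps of
  \<open>A\<close>. By \<open>enumerate_gaps\<close> the rank term in its contribution becomes the
  constant \<open>card A\<close>.\<close>

lemma finite_sets_avoiding:
  assumes "finite A"
  shows "stat_equiv {G. finite G \<and> A \<inter> G = {}} (\<lambda>G. (\<Sum>g\<in>G. g + rank_above A g, card G))
    {S. finite S} (\<lambda>S. (\<Sum>S + card A * card S, card S))"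
proof (rule stat_equiv_sym, rule stat_equivI[where h = "image (enumerate (- A))" and h' = "vimage (enumerate (- A))"],
    goal_cases)
  let ?e = "enumerate (- A)"
  have inf: "infinite (- A)" using assms by simp
  note inj = inj_enumerate[OF inf]
  have ran: "range ?e = - A" using range_enumerate[OF inf] .
  {
    case (1 S)
    then show ?case using ran by auto
  next
    case (2 S)
    show ?case by (rule inj_vimage_image_eq[OF inj])
  next
    case (3 S)
    have "inj_on ?e S" using inj inj_on_subset by blast
    moreover have "(\<Sum>n\<in>S. ?e n + rank_above A (?e n)) = \<Sum>S + card A * card S"
      unfolding enumerate_gaps[OF assms] by (simp add: sum.distrib)
    ultimately show ?case by (simp add: sum.reindex card_image del: sum.distrib) 
  next
    case (4 G)
    then show ?case using inj by (auto intro: finite_vimageI)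
  next
    case (5 G)
    then show ?case using ran by auto
  }
qed


lemma two_tri_nat: "2 * tri (int n) = n * (n - 1)"
proof -
  have "int (2 * tri (int n)) = int (n * (n - 1))"
    using two_tri[of "int n"] by (cases n) (auto simp: algebra_simps)
  then show ?thesis by linarith
qed

lemma finite_sets_avoiding_partitions:
  assumes "finite A"
  shows "stat_equiv {G. finite G \<and> A \<inter> G = {}} (\<lambda>G. (\<Sum>g\<in>G. g + rank_above A g, card G))
    partitions (\<lambda>P. (sum_list P + tri (int (length P)) + card A * length P, length P))"
proof -
  note finite_sets_avoiding[OF assms]
  also have "stat_equiv {S. finite S} (\<lambda>S. (\<Sum>S + card A * card S, card S))
      partitions (\<lambda>P. (sum_list P + tri (int (length P)) + card A * length P, length P))"
    by (rule stat_equiv_map[OF stat_equiv_sym[OF partitions_equiv_finite],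
        where u = "\<lambda>(s, c). (s + card A * c, c)"]) auto
  finally show ?thesis .
qed

text \<open>With \<open>l = length P\<close>, two staircases of weight \<open>tri l\<close> appear,
  one from the ranks within the marked set and one from turning that set into \<open>P\<close>.
  Together they weigh \<open>l * (l - 1)\<close>; adding \<open>N * l\<close> and
  \<open>length A * l\<close> gives the rectangle of \<open>durfee_rectangle\<close> for
  \<open>c = N + length A\<close>.\<close>

lemma split_distincts:
  "stat_equiv (SIGMA \<gamma>:distincts. {\<kappa> \<in> distincts. set \<kappa> \<subseteq> {..<N + length \<gamma>}})
      (\<lambda>(\<gamma>, \<kappa>). (sum_list \<gamma> + sum_list \<kappa>, length \<gamma>, length \<kappa>))
    (({\<kappa> \<in> distincts. set \<kappa> \<subseteq> {..<N}} \<times> distincts) \<times> partitions)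
      (\<lambda>((\<kappa>, A), P). (sum_list \<kappa> + sum_list A + (sum_list P + length P * (N + length A + length P - 1)),
         length A + length P, length \<kappa> + length P))"
  (is "stat_equiv ?X ?f ?Y ?g")
proof -
  have K: "{K. finite K \<and> K \<subseteq> {..<m}} = {K. K \<subseteq> {..<m}}" for m :: nat
    by (auto intro: finite_subset)
  have kappa: "stat_equiv {\<kappa> \<in> distincts. set \<kappa> \<subseteq> {..<m}} (\<lambda>\<kappa>. (sum_list \<kappa>, length \<kappa>))
      {K. K \<subseteq> {..<m}} (\<lambda>K. (\<Sum>K, card K))" for m
    unfolding K[symmetric]
    by (rule stat_equiv_map[OF distincts_equiv_finite[of "\<lambda>K. K \<subseteq> {..<m}"], where u = snd]) auto
  have gamma: "stat_equiv distincts (\<lambda>xs. (sum_list xs, length xs)) {S. finite S} (\<lambda>S. (\<Sum>S, card S))"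
    using stat_equiv_map[OF distincts_equiv_finite[of "\<lambda>_. True"], where u = snd] by simp
  let ?X1 = "SIGMA \<gamma>:distincts. {K. K \<subseteq> {..<N + length \<gamma>}}"
  let ?X2 = "SIGMA \<Gamma>:{S. finite S}. {K. K \<subseteq> {..<N + card \<Gamma>}}"
  let ?X3 = "SIGMA x:{K. K \<subseteq> {..<N}} \<times> {A. finite A}. {G. finite G \<and> snd x \<inter> G = {}}"
  let ?X4 = "({K. K \<subseteq> {..<N}} \<times> {A. finite A}) \<times> partitions"
  have "stat_equiv ?X ?f ?X1 (\<lambda>(\<gamma>, K). (sum_list \<gamma> + \<Sum>K, length \<gamma>, card K))"
    by (rule stat_equiv_map[OF stat_equiv_Sigma_fibre[OF kappa],
          where u = "\<lambda>(\<gamma>, s, c). (sum_list \<gamma> + s, length \<gamma>, c)"]) auto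
  also have "stat_equiv ?X1 (\<lambda>(\<gamma>, K). (sum_list \<gamma> + \<Sum>K, length \<gamma>, card K))
      ?X2 (\<lambda>(\<Gamma>, K). (\<Sum>\<Gamma> + \<Sum>K, card \<Gamma>, card K))"
    using stat_equiv_map[OF stat_equiv_Sigma_base[OF gamma, of "\<lambda>(s, c). {K. K \<subseteq> {..<N + c}}"],
          where u = "\<lambda>((s, c), K). (s + \<Sum>K, c, card K)"] by (simp add: split_beta)
  also note mark_by_rank
  also have "stat_equiv ?X3 (\<lambda>((K, A), G). (\<Sum>K + \<Sum>A + (\<Sum>g\<in>G. g + rank_above A g) + tri (int (card G)) + N * card G,
         card A + card G, card K + card G))
      ?X4 (\<lambda>((K, A), P). (\<Sum>K + \<Sum>A + (sum_list P + tri (int (length P)) + card A * length P) + tri (int (length P))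
         + N * length P, card A + length P, card K + length P))"
    by (rule stat_equiv_map[OF stat_equiv_Sigma_fibre[OF finite_sets_avoiding_partitions],
          where u = "\<lambda>((K, A), s, c). (\<Sum>K + \<Sum>A + s + tri (int c) + N * c, card A + c, card K + c)"]) auto
  also have "stat_equiv ?X4 (\<lambda>((K, A), P). (\<Sum>K + \<Sum>A + (sum_list P + tri (int (length P)) + card A * length P) + tri (int (length P))
         + N * length P, card A + length P, card K + length P)) ?Y ?g"
  proof (rule stat_equiv_map[OF stat_equiv_Times[OF
        stat_equiv_Times[OF stat_equiv_sym[OF kappa[of N]] stat_equiv_sym[OF gamma]]
        stat_equiv_refl[of partitions "\<lambda>P. P" "\<lambda>P. P"]],
        where u = "\<lambda>(((s, c), (s', c')), P). (s + s' + (sum_list P + length P * (N + c' + length P - 1)),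
          c' + length P, c + length P)"], goal_cases)
    case (2 x)
    have "c * l + N * l + 2 * tri (int l) = l * (N + c + l - 1)" for c l
      unfolding two_tri_nat by (cases l) (auto simp: algebra_simps)
    from this[of "card (snd (fst x))" "length (snd x)"] show ?case
      by (auto simp: split_beta)
  qed auto
  finally show ?thesis .
qed

text \<open>The generating function form is
  \<open>\<Sum>m. q ^ (m choose 2) (b/a)\<^sup>m (- a q\<^sup>N; q)\<^sub>m / ((q; q)\<^sub>m (b q\<^sup>N; q)\<^sub>m) = (- b/a; q)\<^sub>\<infinity> / (b q\<^sup>N; q)\<^sub>\<infinity>\<close>.\<close>

lemma one_phi_one:
  "stat_equiv (SIGMA \<gamma>:distincts. {\<kappa> \<in> distincts. set \<kappa> \<subseteq> {..<N + length \<gamma>}} \<times>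
        {\<mu> \<in> partitions. set \<mu> \<subseteq> {..<N + length \<gamma>}})
      (\<lambda>(\<gamma>, \<kappa>, \<mu>). (sum_list \<gamma> + sum_list \<kappa> + sum_list \<mu>,
         int (length \<kappa>) - int (length \<gamma>), length \<gamma> + length \<mu>))
    ({\<kappa> \<in> distincts. set \<kappa> \<subseteq> {..<N}} \<times> distincts \<times> partitions)
      (\<lambda>(\<kappa>, A, B). (sum_list \<kappa> + sum_list A + sum_list B,
         int (length \<kappa>) - int (length A), length A + length B))"
  (is "stat_equiv ?X ?f (?K \<times> distincts \<times> partitions) ?g")
proof -
  let ?M = "\<lambda>m. {\<mu> \<in> partitions. set \<mu> \<subseteq> {..<N + m}}"
  let ?G = "SIGMA \<gamma>:distincts. {\<kappa> \<in> distincts. set \<kappa> \<subseteq> {..<N + length \<gamma>}}"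
  let ?s = "\<lambda>(\<gamma>, \<kappa>). (sum_list \<gamma> + sum_list \<kappa>, length \<gamma>, length \<kappa>)"
  let ?t = "\<lambda>((\<kappa>, A), P). (sum_list \<kappa> + sum_list A + (sum_list P + length P * (N + length A + length P - 1)),
         length A + length P, length \<kappa> + length P)"
  let ?u = "\<lambda>((w, m, k), \<mu>). (w + sum_list \<mu>, int k - int m, m + length \<mu>)"
  let ?Y1 = "SIGMA x:?G. ?M (fst (snd (?s x)))"
  let ?Y2 = "SIGMA x:(?K \<times> distincts) \<times> partitions. ?M (fst (snd (?t x)))"
  let ?Y3 = "SIGMA x:?K \<times> distincts. SIGMA P:partitions. {\<mu> \<in> partitions. set \<mu> \<subseteq> {..<(N + length (snd x)) + length P}}"
  let ?v = "\<lambda>((\<kappa>, A), s, l). (sum_list \<kappa> + sum_list A + s, int (length \<kappa>) - int (length A), length A + l)"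
  let ?r = "\<lambda>((\<kappa>, A), P, \<mu>). ?v ((\<kappa>, A), sum_list P + length P * ((N + length A) + length P - 1) + sum_list \<mu>,
     length P + length \<mu>)"
  have "stat_equiv ?X ?f ?Y1 (\<lambda>(x, \<mu>). ?u (?s x, \<mu>))"
    by (rule stat_equivI[where h = "\<lambda>(\<gamma>, \<kappa>, \<mu>). ((\<gamma>, \<kappa>), \<mu>)" and h' = "\<lambda>((\<gamma>, \<kappa>), \<mu>). (\<gamma>, \<kappa>, \<mu>)"]) auto
  \<comment> \<open>The bound on \<mu> involves only \<open>length \<gamma>\<close>, a component of
    the statistic, so \<mu> is carried along unchanged.\<close>
  also have "stat_equiv ?Y1 (\<lambda>(x, \<mu>). ?u (?s x, \<mu>)) ?Y2 (\<lambda>(x, \<mu>). ?u (?t x, \<mu>))"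
    by (rule stat_equiv_map[OF stat_equiv_Sigma_base[OF split_distincts], where u = ?u]) auto
  \<comment> \<open>Regrouping the bound \<open>N + (length A + length P)\<close> as
    \<open>(N + length A) + length P\<close> lets \<mu> complete \<open>P\<close> to
    \<open>B\<close>.\<close>
  also have "stat_equiv ?Y2 (\<lambda>(x, \<mu>). ?u (?t x, \<mu>)) ?Y3 ?r"
    by (rule stat_equivI[where h = "\<lambda>((x, P), \<mu>). (x, P, \<mu>)" and h' = "\<lambda>(x, P, \<mu>). ((x, P), \<mu>)"])
      (auto simp: add.assoc)
  also have "stat_equiv ?Y3 ?r ((?K \<times> distincts) \<times> partitions) (\<lambda>(x, B). ?v (x, sum_list B, length B))"
    by (rule stat_equiv_map[OF stat_equiv_Sigma_fibre[OF durfee_rectangle], where u = ?v]) auto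
  also have "stat_equiv ((?K \<times> distincts) \<times> partitions) (\<lambda>(x, B). ?v (x, sum_list B, length B))
      (?K \<times> distincts \<times> partitions) ?g"
    by (rule stat_equivI[where h = "\<lambda>((\<kappa>, A), B). (\<kappa>, A, B)" and h' = "\<lambda>(\<kappa>, A, B). ((\<kappa>, A), B)"]) auto
  finally show ?thesis .
qed

subsection \<open>The bijection\<close>

lemma positive_parts_iff: "positive_parts xs \<longleftrightarrow> 0 \<notin> set xs"
  unfolding positive_parts_def by (auto intro: gr0I)

lemma parts_at_most_iff: "parts_at_most (int n - 1) xs \<longleftrightarrow> set xs \<subseteq> {..<n}"
  unfolding parts_at_most_def by auto

lemma distinct_parts_imp_partition: "sorted_wrt (>) xs \<Longrightarrow> is_partition xs"
  unfolding is_partition_def using sorted_wrt_mono_rel[of xs "(>)" "(\<ge>)"] by auto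

lemma script_A_equiv_script_B:
  "stat_equiv (script_A N)
     (\<lambda>(n, \<alpha>, \<beta>, \<gamma>, \<kappa>, \<mu>). (sum_list \<alpha> + sum_list \<beta> + sum_list \<gamma> + sum_list \<kappa> + sum_list \<mu>,
        int (length \<kappa>) - int (length \<alpha>) - int (length \<gamma>), length \<gamma> + length \<mu>))
   (script_B N)
     (\<lambda>(A, B, C, D, E). (sum_list A + sum_list B + sum_list C + sum_list D + sum_list E,
        int (length C) - int (length A) - int (length E), length A + length B))"
  (is "stat_equiv _ ?f _ ?g")
proof -
  let ?D = "{\<alpha> \<in> distincts. 0 \<notin> set \<alpha>}" and ?B = "{\<beta> \<in> partitions. 0 \<notin> set \<beta>}"
  let ?K = "\<lambda>n. {\<kappa> \<in> distincts. set \<kappa> \<subseteq> {..<n}}" and ?M = "\<lambda>n. {\<mu> \<in> partitions. set \<mu> \<subseteq> {..<n}}"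
  let ?T = "SIGMA \<gamma>:distincts. ?K (N + length \<gamma>) \<times> ?M (N + length \<gamma>)"
  let ?Y = "{(C, D, E). C \<in> distincts \<and> D \<in> partitions \<and> E \<in> distincts \<and> 0 \<notin> set E \<and>
      int (length C) + int (length D) - int (length E) = int N}"
  \<comment> \<open>The statistic ignores its first argument; \<open>0\<close> is a placeholder for
    \<open>n\<close>, which is recovered as \<open>N + length \<gamma>\<close>.\<close>
  let ?f1 = "\<lambda>((\<alpha>, \<beta>), \<gamma>, \<kappa>, \<mu>). ?f (0, \<alpha>, \<beta>, \<gamma>, \<kappa>, \<mu>)"
  let ?f2 = "\<lambda>((\<alpha>, \<beta>), \<kappa>, A, B). (sum_list \<alpha> + sum_list \<beta> + (sum_list \<kappa> + sum_list A + sum_list B),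
     int (length \<kappa>) - int (length A) - int (length \<alpha>), length A + length B)"
  let ?f3 = "\<lambda>((\<alpha>, \<beta>, \<kappa>), A, B). ?f2 ((\<alpha>, \<beta>), \<kappa>, A, B)"
  let ?f4 = "\<lambda>((C, D, E), A, B). ?g (A, B, C, D, E)"
  have "stat_equiv (script_A N) ?f ((?D \<times> ?B) \<times> ?T) ?f1"
    by (rule stat_equivI[where h = "\<lambda>(n, \<alpha>, \<beta>, \<gamma>, \<kappa>, \<mu>). ((\<alpha>, \<beta>), \<gamma>, \<kappa>, \<mu>)"
          and h' = "\<lambda>((\<alpha>, \<beta>), \<gamma>, \<kappa>, \<mu>). (N + length \<gamma>, \<alpha>, \<beta>, \<gamma>, \<kappa>, \<mu>)"])
      (auto simp: script_A_def positive_parts_iff parts_at_most_iff distinct_parts_imp_partition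
        distinct_parts_def, auto simp: is_partition_def algebra_simps)
  also have "stat_equiv ((?D \<times> ?B) \<times> ?T) ?f1 ((?D \<times> ?B) \<times> ?K N \<times> distincts \<times> partitions) ?f2"
    by (rule stat_equiv_map[OF stat_equiv_Times[OF stat_equiv_refl[of _ "\<lambda>x. x" "\<lambda>x. x"] one_phi_one],
        where u = "\<lambda>((\<alpha>, \<beta>), w, a, b). (sum_list \<alpha> + sum_list \<beta> + w, a - int (length \<alpha>), b)"]) auto
  also have "stat_equiv ((?D \<times> ?B) \<times> ?K N \<times> distincts \<times> partitions) ?f2
      ((?D \<times> ?B \<times> ?K N) \<times> distincts \<times> partitions) ?f3"
    by (rule stat_equivI[where h = "\<lambda>((\<alpha>, \<beta>), \<kappa>, x). ((\<alpha>, \<beta>, \<kappa>), x)"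
          and h' = "\<lambda>((\<alpha>, \<beta>, \<kappa>), x). ((\<alpha>, \<beta>), \<kappa>, x)"]) auto
  \<comment> \<open>The surviving \<kappa> has its parts below \<open>N\<close>, which is the bound
    \<open>theta_quotient\<close> asks for.\<close>
  also have "stat_equiv ((?D \<times> ?B \<times> ?K N) \<times> distincts \<times> partitions) ?f3
      (?Y \<times> distincts \<times> partitions) ?f4"
    by (rule stat_equiv_map[OF stat_equiv_Times[OF theta_quotient stat_equiv_refl[of _ "\<lambda>x. x" "\<lambda>x. x"]],
        where u = "\<lambda>((w, a), A, B). (w + sum_list A + sum_list B, a - int (length A), length A + length B)"]) auto
  also have "stat_equiv (?Y \<times> distincts \<times> partitions) ?f4 (script_B N) ?g"
    by (rule stat_equivI[where h = "\<lambda>((C, D, E), A, B). (A, B, C, D, E)"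
          and h' = "\<lambda>(A, B, C, D, E). ((C, D, E), A, B)"])
      (auto simp: script_B_def positive_parts_iff distinct_parts_imp_partition
        distinct_parts_def, auto simp: is_partition_def)
  finally show ?thesis .
qed

theorem theorem4p1:
  fixes N :: nat
  shows "\<exists>\<Phi>. bij_betw \<Phi> (script_A N) (script_B N) \<and>
    (\<forall>n \<alpha> \<beta> \<gamma> \<kappa> \<mu> A B C D E.
       (n, \<alpha>, \<beta>, \<gamma>, \<kappa>, \<mu>) \<in> script_A N \<and> \<Phi> (n, \<alpha>, \<beta>, \<gamma>, \<kappa>, \<mu>) = (A, B, C, D, E) \<longrightarrow>
       sum_list \<alpha> + sum_list \<beta> + sum_list \<gamma> + sum_list \<kappa> + sum_list \<mu>
         = sum_list A + sum_list B + sum_list C + sum_list D + sum_list E \<and>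
       int (length \<kappa>) - int (length \<alpha>) - int (length \<gamma>)
         = int (length C) - int (length A) - int (length E) \<and>
       length \<gamma> + length \<mu> = length A + length B)"
proof -
  obtain \<Phi> where \<Phi>: "bij_betw \<Phi> (script_A N) (script_B N)"
    and stat: "\<forall>x\<in>script_A N.
      (case \<Phi> x of (A, B, C, D, E) \<Rightarrow>
         (sum_list A + sum_list B + sum_list C + sum_list D + sum_list E,
          int (length C) - int (length A) - int (length E), length A + length B)) =
      (case x of (n, \<alpha>, \<beta>, \<gamma>, \<kappa>, \<mu>) \<Rightarrow>
         (sum_list \<alpha> + sum_list \<beta> + sum_list \<gamma> + sum_list \<kappa> + sum_list \<mu>,
          int (length \<kappa>) - int (length \<alpha>) - int (length \<gamma>), length \<gamma> + length \<mu>))"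
    using script_A_equiv_script_B[of N] unfolding stat_equiv_def by blast
  show ?thesis
    by (intro exI[of _ \<Phi>] conjI \<Phi> allI impI) (use stat in fastforce)+
qed

end
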